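(* Let $s\le t$ be integers and let $x=x_s+x_{s+1}+\cdots+x_t\in A$ with $x_i\in A_i$ for all $i$. If $x_t\neq 0$, $t>1$ and $C(x_t)=\mathbb F[x_t]$, or if $x_s\neq 0$, $s<-1$ and $C(x_s)=\mathbb F[x_s]$, then $x$ is unsolvable.
   Context: $\mathbb F$ is a field of characteristic zero and $A$ is the (first) Weyl algebra over $\mathbb F$: the associative unital $\mathbb F$-algebra generated by $p,q$ subject to $[p,q]=pq-qp=1$; the elements $p^iq^j$ ($i,j\ge 0$) form a basis of $A$. For $s\in\mathbb Z$, $A_s$ is the $\mathbb F$-span of all $p^iq^j$ with $j-i=s$; this makes $A=\bigoplus_{s\in\mathbb Z}A_s$ a $\mathbb Z$-graded algebra. For $z\in A$, $C(z)=\{y\in A:[z,y]=0\}$ is the centralizer of $z$ and $\mathbb F[z]=\{f(z): f(X)\in\mathbb F[X]\}$. An element $x\in A$ is solvable if there is $y\in A$ with $[x,y]=xy-yx=1$, and unsolvable otherwise. *)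

theory Defs
  imports "HOL-Computational_Algebra.Computational_Algebra"
begin

section \<open>The Weyl algebra\<close>

locale assoc_algebra = vector_space scale
  for scale :: "'f::field \<Rightarrow> 'a::ring_1 \<Rightarrow> 'a" +
  assumes scale_mult_left: "scale c x * y = scale c (x * y)"
    and scale_mult_right: "x * scale c y = scale c (x * y)"

text \<open>
  The Weyl algebra, up to isomorphism: an associative unital algebra with elements \<open>p\<close>, \<open>q\<close>
  satisfying \<open>[p,q] = 1\<close> whose monomials \<open>p^i q^j\<close> are pairwise distinct and form a basis.
  Linear independence of a set says nothing about repetitions in the family of monomials,
  hence the separate injectivity condition. Theorem \<open>weyl_algebra_operators\<close> below shows that
  every field of characteristic zero has such an algebra.
\<close>

locale weyl_algebra = assoc_algebra scale
  for scale :: "'f::field_char_0 \<Rightarrow> 'a::ring_1 \<Rightarrow> 'a" +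
  fixes p q :: 'a
  assumes pq_relation: "p * q - q * p = 1"
    and monomials_inj: "inj (\<lambda>(i::nat, j::nat). p ^ i * q ^ j)"
    and monomials_independent: "independent (range (\<lambda>(i::nat, j::nat). p ^ i * q ^ j))"
    and monomials_span: "span (range (\<lambda>(i::nat, j::nat). p ^ i * q ^ j)) = UNIV"

definition graded_component ::
  "('f::field_char_0 \<Rightarrow> 'a::ring_1 \<Rightarrow> 'a) \<Rightarrow> 'a \<Rightarrow> 'a \<Rightarrow> int \<Rightarrow> 'a set" where
  "graded_component scale p q s =
     module.span scale {p ^ i * q ^ j | i j :: nat. int j - int i = s}"

definition commutator :: "'a::ring_1 \<Rightarrow> 'a \<Rightarrow> 'a" where
  "commutator x y = x * y - y * x"

definition centralizer :: "'a::ring_1 \<Rightarrow> 'a set" where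
  "centralizer z = {y. commutator z y = 0}"

definition eval_poly_at :: "('f::field \<Rightarrow> 'a::ring_1 \<Rightarrow> 'a) \<Rightarrow> 'f poly \<Rightarrow> 'a \<Rightarrow> 'a" where
  "eval_poly_at scale f z = (\<Sum>k\<le>degree f. scale (coeff f k) (z ^ k))"

definition polynomials_in :: "('f::field \<Rightarrow> 'a::ring_1 \<Rightarrow> 'a) \<Rightarrow> 'a \<Rightarrow> 'a set" where
  "polynomials_in scale z = {eval_poly_at scale f z | f. True}"

definition solvable :: "'a::ring_1 \<Rightarrow> bool" where
  "solvable x \<longleftrightarrow> (\<exists>y. commutator x y = 1)"

abbreviation unsolvable :: "'a::ring_1 \<Rightarrow> bool" where
  "unsolvable x \<equiv> \<not> solvable x"


section \<open>Existence\<close>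

lemma of_nat_left_commute: "x * (of_nat n * y) = of_nat n * (x * y :: 'a::ring_1)"
proof -
  have "x * (of_nat n * y) = x * of_nat n * y"
    by (simp only: mult.assoc)
  also have "\<dots> = of_nat n * x * y"
    by (simp only: mult_of_nat_commute)
  finally show ?thesis by (simp only: mult.assoc)
qed

lemma commutator_power_right:
  fixes p q :: "'a::ring_1"
  assumes "p * q - q * p = 1"
  shows "p * q ^ n - q ^ n * p = of_nat n * q ^ (n - 1)"
proof (induction n)
  case (Suc n)
  have "p * q ^ Suc n - q ^ Suc n * p = (p * q - q * p) * q ^ n + q * (p * q ^ n - q ^ n * p)"
    by (simp add: algebra_simps)
  also have "\<dots> = q ^ n + of_nat n * (q * q ^ (n - 1))"
    unfolding assms Suc.IH by (simp add: of_nat_left_commute)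
  also have "\<dots> = of_nat (Suc n) * q ^ n"
    by (cases n) (simp_all add: algebra_simps)
  finally show ?case by simp
qed auto

lemma commutator_power_left:
  fixes p q :: "'a::ring_1"
  assumes "p * q - q * p = 1"
  shows "p ^ n * q - q * p ^ n = of_nat n * p ^ (n - 1)"
proof (induction n)
  case (Suc n)
  have "p ^ Suc n * q - q * p ^ Suc n = p * (p ^ n * q - q * p ^ n) + (p * q - q * p) * p ^ n"
    by (simp add: algebra_simps)
  also have "\<dots> = p ^ n + of_nat n * (p * p ^ (n - 1))"
    unfolding assms Suc.IH by (simp add: of_nat_left_commute)
  also have "\<dots> = of_nat (Suc n) * p ^ n"
    by (cases n) (simp_all add: algebra_simps)
  finally show ?case by simp
qed auto

context assoc_algebra
begin

lemma scale_of_nat: "scale (of_nat n) x = of_nat n * x"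
  by (induction n) (auto simp: scale_left_distrib algebra_simps)

lemma commutator_sum_right:
  "a * (\<Sum>i\<in>I. scale (c i) (f i)) - (\<Sum>i\<in>I. scale (c i) (f i)) * a
     = (\<Sum>i\<in>I. scale (c i) (a * f i - f i * a))"
  by (simp add: sum_distrib_left sum_distrib_right scale_mult_left scale_mult_right
      scale_right_diff_distrib sum_subtractf)

end

lemma powers_independent:
  fixes scale :: "'f::field_char_0 \<Rightarrow> 'a::ring_1 \<Rightarrow> 'a"
  assumes "assoc_algebra scale" and pq: "p * q - q * p = 1"
  shows "(\<Sum>i<m. scale (c i) (p ^ i)) = 0 \<Longrightarrow> i < m \<Longrightarrow> c i = 0"
proof (induction m arbitrary: c i)
  case (Suc m)
  interpret assoc_algebra scale by fact
  have "(\<Sum>i<Suc m. scale (c i) (q * p ^ i - p ^ i * q)) = 0"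
    using commutator_sum_right[of q c "\<lambda>i. p ^ i" "{..<Suc m}"] Suc.prems by simp
  moreover have "q * p ^ i - p ^ i * q = - scale (of_nat i) (p ^ (i - 1))" for i
    using commutator_power_left[OF pq, of i] by (simp add: scale_of_nat algebra_simps)
  ultimately have "(\<Sum>i<Suc m. scale (c i * of_nat i) (p ^ (i - 1))) = 0"
    by (simp add: sum_negf del: sum.lessThan_Suc)
  then have "(\<Sum>i<m. scale (c (Suc i) * of_nat (Suc i)) (p ^ i)) = 0"
    by (simp add: sum.lessThan_Suc_shift del: sum.lessThan_Suc of_nat_Suc)
  from Suc.IH[OF this] have *: "c (Suc i) = 0" if "i < m" for i
    using that by (simp del: of_nat_Suc)
  then have "scale (c 0) 1 = 0"
    using Suc.prems(1) by (simp add: sum.lessThan_Suc_shift del: sum.lessThan_Suc)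
  then have "c 0 = 0" by simp
  with * Suc.prems(2) show ?case by (cases i) auto
qed simp

lemma monomials_rectangle_independent:
  fixes scale :: "'f::field_char_0 \<Rightarrow> 'a::ring_1 \<Rightarrow> 'a"
  assumes "assoc_algebra scale" and pq: "p * q - q * p = 1"
  shows "(\<Sum>j<n. \<Sum>i<m. scale (c i j) (p ^ i * q ^ j)) = 0 \<Longrightarrow> i < m \<Longrightarrow> j < n \<Longrightarrow> c i j = 0"
proof (induction n arbitrary: c i j)
  case (Suc n)
  interpret assoc_algebra scale by fact
  have pos: "c i (Suc j) = 0" if "i < m" "j < n" for i j
  proof -
    have comm: "p * (p ^ i * q ^ j) - p ^ i * q ^ j * p = scale (of_nat j) (p ^ i * q ^ (j - 1))"
      for i j
    proof -
      have "p * (p ^ i * q ^ j) - p ^ i * q ^ j * p = p ^ i * (p * q ^ j - q ^ j * p)"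
        by (simp add: algebra_simps power_commutes flip: mult.assoc)
      then show ?thesis
        using commutator_power_right[OF pq, of j] by (simp add: scale_mult_right flip: scale_of_nat)
    qed
    let ?S = "\<lambda>j. \<Sum>i<m. scale (c i j) (p ^ i * q ^ j)"
    have "0 = p * (\<Sum>j<Suc n. ?S j) - (\<Sum>j<Suc n. ?S j) * p"
      using Suc.prems(1) by simp
    also have "\<dots> = (\<Sum>j<Suc n. p * ?S j - ?S j * p)"
      by (simp only: sum_distrib_left sum_distrib_right sum_subtractf)
    also have "\<dots> = (\<Sum>j<Suc n. \<Sum>i<m. scale (c i j * of_nat j) (p ^ i * q ^ (j - 1)))"
      by (simp only: commutator_sum_right comm scale_scale)
    also have "\<dots> = (\<Sum>j<n. \<Sum>i<m. scale (c i (Suc j) * of_nat (Suc j)) (p ^ i * q ^ j))"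
      by (simp add: sum.lessThan_Suc_shift del: sum.lessThan_Suc of_nat_Suc)
    finally have "(\<Sum>j<n. \<Sum>i<m. scale (c i (Suc j) * of_nat (Suc j)) (p ^ i * q ^ j)) = 0"
      by simp
    from Suc.IH[OF this that] show ?thesis by (simp del: of_nat_Suc)
  qed
  then have "(\<Sum>j<n. \<Sum>i<m. scale (c i (Suc j)) (p ^ i * q ^ Suc j)) = 0"
    by simp
  then have "(\<Sum>i<m. scale (c i 0) (p ^ i)) = 0"
    using Suc.prems(1) by (simp add: sum.lessThan_Suc_shift del: sum.lessThan_Suc)
  from powers_independent[OF assms this] have "c i 0 = 0" if "i < m" for i
    using that by blast
  with pos Suc.prems(2,3) show ?case by (cases j) auto
qed simp

lemma monomials_family_independent:
  fixes scale :: "'f::field_char_0 \<Rightarrow> 'a::ring_1 \<Rightarrow> 'a"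
  assumes alg: "assoc_algebra scale" and pq: "p * q - q * p = 1"
    and T: "finite T" and sum0: "(\<Sum>(i, j)\<in>T. scale (u (i, j)) (p ^ i * q ^ j)) = 0"
    and x: "x \<in> T"
  shows "u x = 0"
proof -
  interpret assoc_algebra scale by fact
  define N where "N = Suc (Max (fst ` T \<union> snd ` T))"
  have N: "i < N \<and> j < N" if "(i, j) \<in> T" for i j
    unfolding N_def using that T by (force simp: less_Suc_eq_le intro!: Max_ge)
  define c where "c i j = (if (i, j) \<in> T then u (i, j) else 0)" for i j
  have "(\<Sum>j<N. \<Sum>i<N. scale (c i j) (p ^ i * q ^ j))
      = (\<Sum>(i, j)\<in>{..<N} \<times> {..<N}. scale (c i j) (p ^ i * q ^ j))"
    by (subst sum.swap) (simp add: sum.cartesian_product)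
  also have "\<dots> = (\<Sum>(i, j)\<in>T. scale (u (i, j)) (p ^ i * q ^ j))"
    using N by (intro sum.mono_neutral_cong_right) (auto simp: c_def)
  finally have "(\<Sum>j<N. \<Sum>i<N. scale (c i j) (p ^ i * q ^ j)) = 0"
    using sum0 by simp
  from monomials_rectangle_independent[OF alg pq this, of "fst x" "snd x"]
  show ?thesis using x N[of "fst x" "snd x"] by (simp add: c_def)
qed

lemma weyl_algebraI:
  fixes scale :: "'f::field_char_0 \<Rightarrow> 'a::ring_1 \<Rightarrow> 'a"
  assumes alg: "assoc_algebra scale" and pq: "p * q - q * p = 1"
    and span: "module.span scale (range (\<lambda>(i::nat, j::nat). p ^ i * q ^ j)) = UNIV"
  shows "weyl_algebra scale p q"
proof -
  interpret assoc_algebra scale by fact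
  let ?m = "\<lambda>(i::nat, j::nat). p ^ i * q ^ j"
  have indep: "u x = 0" if "finite T" "(\<Sum>x\<in>T. scale (u x) (?m x)) = 0" "x \<in> T" for T u x
    using monomials_family_independent[OF alg pq that(1) _ that(3), of u] that(2)
    by (simp add: case_prod_unfold)
  have inj: "inj ?m"
  proof (rule injI, rule ccontr)
    fix x y assume eq: "?m x = ?m y" and ne: "x \<noteq> y"
    let ?u = "\<lambda>z. if z = x then 1 else - 1 :: 'f"
    have "(\<Sum>z\<in>{x, y}. scale (?u z) (?m z)) = 0"
      using eq ne by auto
    from indep[OF _ this, of x] show False by simp
  qed
  moreover have "independent (range ?m)"
    unfolding independent_explicit_module
  proof (intro allI impI)
    fix t u v
    assume t: "finite t" "t \<subseteq> range ?m" "(\<Sum>v\<in>t. scale (u v) v) = 0" "v \<in> t"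
    then obtain T where T: "finite T" "t = ?m ` T"
      by (meson finite_subset_image)
    have "(\<Sum>x\<in>T. scale (u (?m x)) (?m x)) = 0"
      using t(3) unfolding T(2) by (subst (asm) sum.reindex) (auto intro: inj_on_subset[OF inj])
    from indep[OF T(1) this] T(2) t(4) show "u v = 0" by blast
  qed
  ultimately show ?thesis
    using span pq by unfold_locales auto
qed

text \<open>The algebra of polynomial differential operators in one variable.\<close>

inductive_set diff_operators :: "('f::field_char_0 poly \<Rightarrow> 'f poly) set" where
  deriv: "pderiv \<in> diff_operators"
| shift: "pCons 0 \<in> diff_operators"
| const: "smult c \<in> diff_operators"
| add: "S \<in> diff_operators \<Longrightarrow> T \<in> diff_operators \<Longrightarrow> (\<lambda>f. S f + T f) \<in> diff_operators"
| comp: "S \<in> diff_operators \<Longrightarrow> T \<in> diff_operators \<Longrightarrow> (\<lambda>f. S (T f)) \<in> diff_operators"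

lemma diff_operators_linear:
  assumes "T \<in> diff_operators"
  shows "T (f + g) = T f + T g" "T (smult c f) = smult c (T f)"
proof -
  have "(\<forall>f g. T (f + g) = T f + T g) \<and> (\<forall>c f. T (smult c f) = smult c (T f))"
    using assms by induction (auto simp: pderiv_add pderiv_smult smult_add_right algebra_simps)
  then show "T (f + g) = T f + T g" "T (smult c f) = smult c (T f)" by auto
qed

typedef (overloaded) 'f diff_op = "diff_operators :: ('f::field_char_0 poly \<Rightarrow> 'f poly) set"
  using diff_operators.deriv by blast

setup_lifting type_definition_diff_op

instantiation diff_op :: (field_char_0) ring_1
begin

lift_definition zero_diff_op :: "'a diff_op" is "\<lambda>_. 0"
  by (rule back_subst[of "\<lambda>T. T \<in> diff_operators", OF diff_operators.const[of 0]]) auto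

lift_definition one_diff_op :: "'a diff_op" is "\<lambda>f. f"
  by (rule back_subst[of "\<lambda>T. T \<in> diff_operators", OF diff_operators.const[of 1]]) auto

lift_definition plus_diff_op :: "'a diff_op \<Rightarrow> 'a diff_op \<Rightarrow> 'a diff_op" is "\<lambda>S T f. S f + T f"
  by (rule diff_operators.add)

lift_definition uminus_diff_op :: "'a diff_op \<Rightarrow> 'a diff_op" is "\<lambda>T f. - T f"
  using diff_operators.comp[OF diff_operators.const[of "-1::'a"]] by simp

lift_definition minus_diff_op :: "'a diff_op \<Rightarrow> 'a diff_op \<Rightarrow> 'a diff_op" is "\<lambda>S T f. S f - T f"
  using diff_operators.add[OF _ diff_operators.comp[OF diff_operators.const[of "-1::'a"]]] by simp

lift_definition times_diff_op :: "'a diff_op \<Rightarrow> 'a diff_op \<Rightarrow> 'a diff_op" is "\<lambda>S T f. S (T f)"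
  by (rule diff_operators.comp)

instance
  by standard (transfer; auto simp: fun_eq_iff diff_operators_linear intro: exI[of _ 1])+

end

lift_definition scale_diff_op :: "'f::field_char_0 \<Rightarrow> 'f diff_op \<Rightarrow> 'f diff_op"
  is "\<lambda>c T f. smult c (T f)"
  by (rule diff_operators.comp[OF diff_operators.const])

lift_definition deriv_op :: "'f::field_char_0 diff_op" is pderiv
  by (rule diff_operators.deriv)

lift_definition shift_op :: "'f::field_char_0 diff_op" is "pCons 0"
  by (rule diff_operators.shift)

lemma assoc_algebra_diff_op: "assoc_algebra (scale_diff_op :: 'f::field_char_0 \<Rightarrow> _)"
  by unfold_locales
    (transfer; simp add: fun_eq_iff smult_add_right smult_add_left diff_operators_linear)+

lemma deriv_shift_relation: "deriv_op * shift_op - shift_op * deriv_op = (1 :: 'f::field_char_0 diff_op)"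
  by transfer (simp add: fun_eq_iff pderiv_pCons)

lemma diff_op_induct [case_names deriv shift const add mult]:
  fixes T :: "'f::field_char_0 diff_op"
  assumes "P deriv_op" "P shift_op" "\<And>c. P (scale_diff_op c 1)"
    "\<And>S T. P S \<Longrightarrow> P T \<Longrightarrow> P (S + T)" "\<And>S T. P S \<Longrightarrow> P T \<Longrightarrow> P (S * T)"
  shows "P T"
proof -
  have "\<exists>S. Rep_diff_op S = F \<and> P S" if "F \<in> diff_operators" for F
    using that
  proof (induction rule: diff_operators.induct)
    case deriv then show ?case using assms(1) deriv_op.rep_eq by blast
  next
    case shift then show ?case using assms(2) shift_op.rep_eq by blast
  next
    case (const c)
    have "Rep_diff_op (scale_diff_op c 1) = smult c"
      by (simp add: scale_diff_op.rep_eq one_diff_op.rep_eq)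
    then show ?case using assms(3) by blast
  next
    case add then show ?case using assms(4) plus_diff_op.rep_eq by metis
  next
    case comp then show ?case using assms(5) times_diff_op.rep_eq by metis
  qed
  from this[OF Rep_diff_op[of T]] show ?thesis
    by (auto simp: Rep_diff_op_inject)
qed

theorem weyl_algebra_operators:
  "weyl_algebra scale_diff_op deriv_op (shift_op :: 'f::field_char_0 diff_op)"
proof (rule weyl_algebraI[OF assoc_algebra_diff_op deriv_shift_relation])
  interpret assoc_algebra "scale_diff_op :: 'f \<Rightarrow> _" by (rule assoc_algebra_diff_op)
  let ?p = "deriv_op :: 'f diff_op" and ?q = "shift_op :: 'f diff_op"
  let ?M = "range (\<lambda>(i::nat, j::nat). ?p ^ i * ?q ^ j)"
  have mono: "?p ^ i * ?q ^ j \<in> span ?M" for i j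
    by (rule span_base) (auto intro: image_eqI[of _ _ "(i, j)"])
  have lin: "(\<And>x. x \<in> ?M \<Longrightarrow> T * x \<in> span ?M) \<Longrightarrow> y \<in> span ?M \<Longrightarrow> T * y \<in> span ?M" for T y
  proof -
    assume *: "\<And>x. x \<in> ?M \<Longrightarrow> T * x \<in> span ?M" and "y \<in> span ?M"
    from this(2) show "T * y \<in> span ?M"
      by (induction rule: span_induct_alt)
        (auto simp: distrib_left scale_mult_right intro!: span_add span_scale span_zero *)
  qed
  have main: "T * y \<in> span ?M" if "y \<in> span ?M" for T y
    using that
  proof (induction T arbitrary: y rule: diff_op_induct)
    case deriv
    show ?case
    proof (rule lin[OF _ deriv])
      fix x assume "x \<in> ?M"
      then obtain i j where "x = ?p ^ i * ?q ^ j" by auto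
      then show "?p * x \<in> span ?M" using mono[of "Suc i" j] by (simp add: mult.assoc)
    qed
  next
    case shift
    show ?case
    proof (rule lin[OF _ shift])
      fix x assume "x \<in> ?M"
      then obtain i j where x: "x = ?p ^ i * ?q ^ j" by auto
      have "?q * ?p ^ i = ?p ^ i * ?q - scale_diff_op (of_nat i) (?p ^ (i - 1))"
        using commutator_power_left[OF deriv_shift_relation[where 'f='f], of i]
        by (simp add: scale_of_nat algebra_simps)
      then have "?q * x = ?p ^ i * ?q ^ Suc j - scale_diff_op (of_nat i) (?p ^ (i - 1) * ?q ^ j)"
        unfolding x by (simp add: scale_mult_left left_diff_distrib flip: mult.assoc)
      then show "?q * x \<in> span ?M"
        using mono by (metis span_diff span_scale)
    qed
  next
    case (const c)
    then show ?case by (simp add: scale_mult_left span_scale)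
  next
    case (add S T)
    then show ?case by (simp add: distrib_right span_add)
  next
    case (mult S T)
    then show ?case by (simp add: mult.assoc)
  qed
  have "T \<in> span ?M" for T
    using main[of 1 T] mono[of 0 0] by simp
  then show "span ?M = UNIV" by blast
qed

end

theory Submission
  imports Defs
begin

text \<open>
  Let \<open>x\<close> have leading component \<open>z\<close> of degree \<open>t > 1\<close> with \<open>C(z) = F[z]\<close>, and suppose
  that \<open>[x, y] = 1\<close>. If \<open>u\<close> is the leading component of \<open>y\<close>, of degree \<open>n\<close>, then \<open>[z, u]\<close> is
  the component of degree \<open>t + n\<close> of \<open>[x, y] = 1\<close>. As long as \<open>t + n > 0\<close> it has to vanish, so
  \<open>u\<close> lies in \<open>C(z) = F[z]\<close>; being homogeneous, it is a monomial \<open>a z^k\<close>. Replacing \<open>y\<close> by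
  \<open>y - a x^k\<close> does not change the commutator with \<open>x\<close> and lowers the degree of \<open>y\<close>. The descent
  ends with \<open>n \<le> - t\<close>. If \<open>n < - t\<close>, the degree of \<open>[x, y]\<close> is too small for it to be \<open>1\<close>; so
  \<open>n = - t\<close> and \<open>[z, u] = 1\<close>. This argument works in any graded algebra in which no
  commutator of an element of degree \<open>- t\<close> with \<open>z\<close> is \<open>1\<close>; it is
  \<open>unsolvable_of_leading_component\<close>.

  It remains to see that homogeneous elements \<open>u\<close>, \<open>v\<close> of degrees \<open>n\<close> and \<open>- n\<close> with \<open>n > 1\<close>
  never satisfy \<open>[u, v] = 1\<close> (\<open>homogeneous_commutator_ne_one_nat\<close>). With \<open>g = p q\<close> one has
  \<open>u = f(g) q^n\<close> and \<open>v = p^n k(g)\<close>. Moving \<open>p\<close> or \<open>q\<close> past \<open>g\<close> translates \<open>g\<close> by one, so that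
  \<open>u v = F(g)\<close> and \<open>v u = F(g + n)\<close>, where \<open>F = f k (X - 1) \<dots> (X - n)\<close>. Since \<open>g\<close> is
  transcendental, \<open>F(X) - F(X + n) = 1\<close>. But \<open>F\<close> vanishes at both \<open>1\<close> and \<open>2\<close>, which is
  impossible (\<open>no_shift_antiderivative\<close>): over a field of characteristic zero, the only
  polynomials with this difference are the affine ones of slope \<open>- 1 / n\<close>.

  The hypothesis on the lowest component is the same statement for the grading with all degrees
  negated; this is why the descent is carried out for an abstract grading.
\<close>

section \<open>Polynomials under translation of the variable\<close>

lemma infinite_arithmetic_progression: "infinite (range (\<lambda>n. c * of_nat n + b :: 'f::field_char_0))" if "c \<noteq> 0"
  by (rule range_inj_infinite) (use that in \<open>auto simp: inj_def\<close>)

lemma poly_eq_0_of_arithmetic_progression: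
  assumes "c \<noteq> 0" "\<And>n. poly P (c * of_nat n + b :: 'f::field_char_0) = 0"
  shows "P = 0"
  using poly_roots_finite[of P] infinite_arithmetic_progression[OF assms(1), of b] assms(2)
  by (metis (mono_tags, lifting) finite_subset image_subsetI mem_Collect_eq)

definition rising :: "nat \<Rightarrow> 'f::field_char_0 poly" where
  "rising n = (\<Prod>j<n. [:of_nat j, 1:])"

definition falling :: "nat \<Rightarrow> 'f::field_char_0 poly" where
  "falling n = (\<Prod>j<n. [:- of_nat (Suc j), 1:])"

lemma rising_Suc: "rising (Suc n) = [:of_nat n, 1:] * rising n"
  by (simp only: rising_def prod.lessThan_Suc mult.commute)

lemma falling_Suc: "falling (Suc n) = [:- of_nat (Suc n), 1:] * falling n"
  by (simp only: falling_def prod.lessThan_Suc mult.commute)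

text \<open>
  This is what makes \<open>u v\<close> and \<open>v u\<close> translates of each other for homogeneous \<open>u\<close>, \<open>v\<close> of opposite
  degrees: \<open>p^n q^n\<close> and \<open>q^n p^n\<close> are the values of these two polynomials at \<open>p q\<close>.
\<close>

lemma rising_eq_shifted_falling: "(rising n :: 'f::field_char_0 poly) = pcompose (falling n) [:of_nat n, 1:]"
proof -
  have "poly (rising n) x = poly (pcompose (falling n) [:of_nat n, 1:]) x" for x :: 'f
  proof -
    have "poly (pcompose (falling n) [:of_nat n, 1:]) x = (\<Prod>j<n. x + of_nat (n - Suc j))"
      by (auto simp: falling_def poly_pcompose poly_prod of_nat_diff intro!: prod.cong)
    also have "\<dots> = (\<Prod>j<n. x + of_nat j)"
      by (rule prod.nat_diff_reindex)
    finally show ?thesis by (simp add: rising_def poly_prod add.commute)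
  qed
  then show ?thesis by (simp add: poly_eq_poly_eq_iff[symmetric] fun_eq_iff)
qed

text \<open>
  The equation gives \<open>F(1 + k n) = F(1) - k\<close> and \<open>F(2 + k n) = F(2) - k\<close> for every \<open>k\<close>, so that
  \<open>F(X + 1) - F(X)\<close> has infinitely many zeros and \<open>F\<close> is periodic with period 1. Then
  \<open>F(X) - F(X + n)\<close> is \<open>0\<close>.
\<close>

lemma no_shift_antiderivative:
  assumes n: "n > 0" and eq: "\<And>x. poly F x - poly F (x + of_nat n) = (1 :: 'f::field_char_0)"
    and ab: "poly F 1 = poly F 2"
  shows False
proof -
  have "pcompose F [:1, 1:] - F = 0"
  proof (rule poly_eq_0_of_arithmetic_progression[of "of_nat n" _ 1])
    show "poly (pcompose F [:1, 1:] - F) (of_nat n * of_nat k + 1) = 0" for k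
    proof (induction k)
      case 0
      then show ?case using ab by (simp add: poly_pcompose)
    next
      case (Suc k)
      show ?case
        using Suc eq[of "of_nat n * of_nat k + 1"] eq[of "of_nat n * of_nat k + 2"]
        by (simp add: poly_pcompose algebra_simps)
    qed
  qed (use n in simp)
  then have "poly (pcompose F [:1, 1:] - F) x = 0" for x
    by simp
  then have step: "poly F (1 + x) = poly F x" for x
    by (simp add: poly_pcompose)
  have "poly F (of_nat m) = poly F 0" for m
    by (induction m) (simp_all add: step)
  with eq[of 0] show False by simp
qed

section \<open>Evaluating polynomials at an element of an algebra\<close>

context assoc_algebra
begin

abbreviation ev :: "'f poly \<Rightarrow> 'a \<Rightarrow> 'a" where
  "ev \<equiv> eval_poly_at scale"

lemma eval_pCons: "ev (pCons a P) z = scale a 1 + z * ev P z"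
proof (cases "P = 0")
  case True
  then show ?thesis by (simp add: eval_poly_at_def)
next
  case False
  have "ev (pCons a P) z = (\<Sum>k\<le>Suc (degree P). scale (coeff (pCons a P) k) (z ^ k))"
    using False by (simp add: eval_poly_at_def)
  also have "\<dots> = scale a 1 + (\<Sum>k\<le>degree P. scale (coeff P k) (z * z ^ k))"
    by (simp add: sum.atMost_Suc_shift del: sum.atMost_Suc)
  also have "\<dots> = scale a 1 + z * ev P z"
    by (simp add: eval_poly_at_def sum_distrib_left scale_mult_right)
  finally show ?thesis .
qed

lemma eval_0: "ev 0 z = 0"
  by (simp add: eval_poly_at_def)

lemma eval_1: "ev 1 z = 1"
  by (simp add: eval_poly_at_def)

lemma eval_linear: "ev [:a, 1:] z = scale a 1 + z"
  by (simp add: eval_pCons eval_0)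

lemma eval_add: "ev (P + Q) z = ev P z + ev Q z"
  by (induction P Q rule: poly_induct2) (simp_all add: eval_0 eval_pCons scale_left_distrib algebra_simps)

lemma eval_smult: "ev (smult c P) z = scale c (ev P z)"
  by (induction P) (simp_all add: eval_0 eval_pCons scale_right_distrib scale_mult_right)

lemma eval_diff: "ev (P - Q) z = ev P z - ev Q z"
  using eval_add[of "P - Q" Q z] by simp

lemma eval_mult: "ev (P * Q) z = ev P z * ev Q z"
  by (induction P)
    (simp_all add: eval_0 eval_pCons eval_add eval_smult scale_mult_left algebra_simps)

lemma eval_pcompose: "ev (pcompose P Q) z = ev P (ev Q z)"
  by (induction P)
    (simp_all add: eval_0 eval_pCons eval_add eval_mult pcompose_pCons)

text \<open>
  With \<open>u = g\<close> and \<open>v = g \<plusminus> n\<close> this moves powers of \<open>p\<close> and \<open>q\<close> past polynomials in \<open>g\<close>.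
\<close>

lemma eval_intertwine:
  assumes "a * u = v * a"
  shows "a * ev P u = ev P v * a"
proof (induction P)
  case (pCons b P)
  have "a * (u * ev P u) = v * (a * ev P u)"
    by (metis assms mult.assoc)
  with pCons show ?case
    by (simp add: eval_pCons distrib_left distrib_right scale_mult_left scale_mult_right mult.assoc)
qed (simp add: eval_0)

text \<open>
  Taylor expansion of order zero at \<open>a\<close>: modulo the right ideal generated by \<open>u\<close>, only the
  constant \<open>P(a)\<close> is left.
\<close>

lemma eval_remainder: "\<exists>c. ev P (u + scale a 1) = scale (poly P a) 1 + u * c"
proof (induction P)
  case (pCons b P)
  then obtain c where "ev P (u + scale a 1) = scale (poly P a) 1 + u * c" by blast
  then have "ev (pCons b P) (u + scale a 1)
      = scale (poly (pCons b P) a) 1 + u * (scale (poly P a) 1 + u * c + scale a c)"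
    by (simp add: eval_pCons scale_mult_left scale_mult_right scale_left_distrib
        scale_right_distrib algebra_simps)
  then show ?case by blast
qed (auto simp: eval_0 intro: exI[of _ 0])

lemma commutator_add_right: "commutator a (y + z) = commutator a y + commutator a z"
  and commutator_diff_right: "commutator a (y - z) = commutator a y - commutator a z"
  and commutator_scale_right: "commutator a (scale c y) = scale c (commutator a y)"
  by (simp_all add: commutator_def algebra_simps scale_mult_left scale_mult_right
      scale_right_diff_distrib)

end

section \<open>Graded algebras\<close>

locale graded_algebra = assoc_algebra scale
  for scale :: "'f::field \<Rightarrow> 'a::ring_1 \<Rightarrow> 'a" +
  fixes G :: "int \<Rightarrow> 'a set"
  assumes subspace_G: "subspace (G i)"
    and mult_G: "x \<in> G i \<Longrightarrow> y \<in> G j \<Longrightarrow> x * y \<in> G (i + j)"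
    and one_G: "1 \<in> G 0"
    and spanning: "span (\<Union>i. G i) = UNIV"
    and direct: "x \<in> G i \<Longrightarrow> x \<in> span (\<Union>j\<in>- {i}. G j) \<Longrightarrow> x = 0"
begin

text \<open>
  Exchanges highest and lowest components.
\<close>

lemma opposite_grading: "graded_algebra scale (\<lambda>i. G (- i))"
proof unfold_locales
  show "subspace (G (- i))" for i by (rule subspace_G)
  show "x * y \<in> G (- (i + j))" if "x \<in> G (- i)" "y \<in> G (- j)" for x y i j
    using mult_G[OF that] by simp
  show "1 \<in> G (- 0)" using one_G by simp
  have "(\<Union>i. G (- i)) = (\<Union>i. G i)"
    by (metis surj_def minus_minus UN_extend_simps(10) image_cong range_composition surj_uminus)
  then show "span (\<Union>i. G (- i)) = UNIV" using spanning by simp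
  show "x = 0" if "x \<in> G (- i)" "x \<in> span (\<Union>j\<in>- {i}. G (- j))" for x i
  proof (rule direct[OF that(1)])
    have "(\<Union>j\<in>- {i}. G (- j)) \<subseteq> (\<Union>j\<in>- {- i}. G j)"
    proof (rule UN_least)
      show "G (- j) \<subseteq> (\<Union>j\<in>- {- i}. G j)" if "j \<in> - {i}" for j
        by (rule UN_upper) (use that in simp)
    qed
    then show "x \<in> span (\<Union>j\<in>- {- i}. G j)" using that(2) span_mono by blast
  qed
qed

definition filt :: "int \<Rightarrow> 'a set" where
  "filt n = span (\<Union>i\<in>{..n}. G i)"

lemma subspace_filt: "subspace (filt n)"
  by (simp add: filt_def)

lemmas filt_add = subspace_add[OF subspace_filt]
  and filt_diff = subspace_diff[OF subspace_filt]
  and filt_scale = subspace_scale[OF subspace_filt]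
  and filt_0 = subspace_0[OF subspace_filt]

lemma filt_mono: "m \<le> n \<Longrightarrow> x \<in> filt m \<Longrightarrow> x \<in> filt n"
  unfolding filt_def by (rule subsetD[OF span_mono[OF UN_mono]]) auto

lemma G_filt: "x \<in> G i \<Longrightarrow> i \<le> n \<Longrightarrow> x \<in> filt n"
  unfolding filt_def by (rule span_base) auto

lemma G_filt_zero: "x \<in> G n \<Longrightarrow> x \<in> filt m \<Longrightarrow> m < n \<Longrightarrow> x = 0"
  by (rule direct, assumption, unfold filt_def, rule subsetD[OF span_mono[OF UN_mono]]) auto

lemma filt_mult:
  assumes "x \<in> filt m" "y \<in> filt n"
  shows "x * y \<in> filt (m + n)"
proof -
  have homogeneous: "a * y \<in> filt (m + n)" if "a \<in> G i" "i \<le> m" for a i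
    using assms(2) unfolding filt_def[of n]
  proof (induction rule: span_induct_alt)
    case base
    then show ?case by (simp add: filt_0)
  next
    case (step c b z)
    then obtain j where "b \<in> G j" "j \<le> n" by auto
    then have "a * b \<in> filt (m + n)"
      using G_filt[OF mult_G] that by simp
    with step show ?case
      by (simp add: distrib_left scale_mult_right filt_add filt_scale)
  qed
  show ?thesis
    using assms(1) unfolding filt_def[of m]
    by (induction rule: span_induct_alt)
      (auto simp: distrib_right scale_mult_left filt_0 intro!: filt_add filt_scale homogeneous)
qed

lemma filt_exhaust: "\<exists>n. y \<in> filt n"
proof -
  have "y \<in> span (\<Union>i. G i)" using spanning by simp
  then show ?thesis
  proof (induction rule: span_induct_alt)
    case base
    then show ?case using filt_0 by blast
  next
    case (step c b z)
    then obtain i n where "b \<in> G i" "z \<in> filt n" by auto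
    then have "b \<in> filt (max i n)" "z \<in> filt (max i n)"
      by (auto intro: G_filt filt_mono[of n])
    then show ?case using filt_add filt_scale by blast
  qed
qed

lemma leading_component:
  assumes "y \<in> filt n"
  obtains u where "u \<in> G n" "y - u \<in> filt (n - 1)"
proof -
  have "\<exists>u \<in> G n. y - u \<in> filt (n - 1)"
    using assms unfolding filt_def[of n]
  proof (induction rule: span_induct_alt)
    case base
    then show ?case using subspace_0[OF subspace_G] filt_0 by force
  next
    case (step c b z)
    then obtain i u where i: "b \<in> G i" "i \<le> n" and u: "u \<in> G n" "z - u \<in> filt (n - 1)"
      by auto
    show ?case
    proof (cases "i = n")
      case True
      have "scale c b + z - (scale c b + u) \<in> filt (n - 1)" using u by simp
      moreover have "scale c b + u \<in> G n"
        using i u True subspace_add[OF subspace_G] subspace_scale[OF subspace_G] by blast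
      ultimately show ?thesis by blast
    next
      case False
      then have "b \<in> filt (n - 1)" using i G_filt by simp
      then have "scale c b + (z - u) \<in> filt (n - 1)"
        using u filt_add filt_scale by blast
      then show ?thesis using u(1) by (auto simp: add_diff_eq)
    qed
  qed
  then show ?thesis using that by blast
qed

lemma power_G:
  assumes "z \<in> G t"
  shows "z ^ k \<in> G (int k * t)"
proof (induction k)
  case 0
  then show ?case using one_G by simp
next
  case (Suc k)
  show ?case using mult_G[OF assms Suc] by (simp add: algebra_simps)
qed

lemma filt_power_diff:
  assumes "z \<in> G t" and "x - z \<in> filt (t - 1)"
  shows "x ^ k - z ^ k \<in> filt (int k * t - 1)"
proof (induction k)
  case 0
  then show ?case by (simp add: filt_0)
next
  case (Suc k)
  have "x \<in> filt t"
    using filt_add[OF G_filt[OF assms(1) order_refl] filt_mono[OF _ assms(2), of t]] by simp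
  from filt_mult[OF this Suc] have "x * (x ^ k - z ^ k) \<in> filt (int (Suc k) * t - 1)"
    by (simp add: algebra_simps)
  moreover have "(x - z) * z ^ k \<in> filt (int (Suc k) * t - 1)"
    using filt_mult[OF assms(2) G_filt[OF power_G[OF assms(1), of k] order_refl]]
    by (simp add: algebra_simps)
  ultimately show ?case
    using filt_add by (fastforce simp: algebra_simps)
qed

text \<open>
  Induction on the number of terms: the last term \<open>T = c z^d\<close> has a larger degree than all others. If
  it lies above degree \<open>n\<close>, it must vanish and can be dropped; if it lies in degree \<open>n\<close>, it is all
  of \<open>u\<close>; if the whole sum lies below degree \<open>n\<close>, then \<open>u = 0\<close>.
\<close>

lemma homogeneous_polynomial_is_monomial:
  assumes z: "z \<in> G t" and t: "t > 0" and u: "u \<in> G n" and nz: "u \<noteq> 0"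
    and eq: "u = (\<Sum>k\<le>d. scale (c k) (z ^ k))"
  shows "\<exists>a k. u = scale a (z ^ k) \<and> int k * t = n"
  using eq
proof (induction d)
  case 0
  have "u \<in> G 0"
    using 0 one_G subspace_scale[OF subspace_G] by simp
  then have "n = 0"
    using G_filt_zero[OF u G_filt, of 0 0] G_filt_zero[OF _ G_filt[OF u order_refl], of 0] nz
    by (metis linorder_neqE_linordered_idom order_refl)
  with 0 show ?case by (intro exI[of _ "c 0"] exI[of _ 0]) auto
next
  case (Suc d)
  define m where "m = int (Suc d) * t"
  define T where "T = scale (c (Suc d)) (z ^ Suc d)"
  define rest where "rest = (\<Sum>k\<le>d. scale (c k) (z ^ k))"
  have eq: "u = rest + T"
    using Suc.prems by (simp add: T_def rest_def)
  have T: "T \<in> G m"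
    unfolding T_def m_def by (intro subspace_scale[OF subspace_G] power_G z)
  have rest: "rest \<in> filt (m - 1)"
    unfolding rest_def
  proof (intro subspace_sum[OF subspace_filt] filt_scale G_filt[OF power_G[OF z]])
    fix k assume "k \<in> {..d}"
    then have "int k < int (Suc d)" by simp
    then have "int k * t < int (Suc d) * t" using t by (rule mult_strict_right_mono)
    then show "int k * t \<le> m - 1" by (simp add: m_def)
  qed
  consider "n < m" | "n = m" | "m < n" by linarith
  then show ?case
  proof cases
    case 1
    have "u - rest \<in> filt (m - 1)"
      using 1 G_filt[OF u, of "m - 1"] rest by (intro filt_diff) auto
    then have "T = 0" using eq G_filt_zero[OF T, of "m - 1"] by simp
    then show ?thesis using Suc.IH eq by (simp add: rest_def)
  next
    case 2
    have "u - T \<in> G n" using 2 u T subspace_diff[OF subspace_G] by blast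
    then have "u - T = 0" using rest eq G_filt_zero[of "u - T" n "m - 1"] 2 by simp
    then show ?thesis
      using 2 unfolding T_def m_def by (intro exI[of _ "c (Suc d)"] exI[of _ "Suc d"]) simp
  next
    case 3
    have "u \<in> filt m"
      unfolding eq using filt_add[OF filt_mono[OF _ rest, of m] G_filt[OF T order_refl]] by simp
    then show ?thesis using G_filt_zero[OF u] 3 nz by blast
  qed
qed

text \<open>
  The descent: an element \<open>y\<close> with \<open>[x, y] = 1\<close> whose leading degree \<open>n\<close> satisfies \<open>t + n > 0\<close> can be
  replaced by one of smaller degree, and neither \<open>t + n = 0\<close> nor \<open>t + n < 0\<close> is possible. The
  degree \<open>n\<close> may be negative, hence the induction on \<open>nat (n + t)\<close>.
\<close>

theorem unsolvable_of_leading_component: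
  assumes z: "z \<in> G t" and t: "t > 0" and x: "x - z \<in> filt (t - 1)"
    and centr: "centralizer z = polynomials_in scale z"
    and key: "\<And>v. v \<in> G (- t) \<Longrightarrow> commutator z v \<noteq> 1"
  shows "unsolvable x"
proof -
  have main: "commutator x y \<noteq> 1" if "y \<in> filt n" for y n
    using that
  proof (induction "nat (n + t)" arbitrary: y n rule: less_induct)
    case less
    obtain u where u: "u \<in> G n" "y - u \<in> filt (n - 1)"
      using leading_component[OF less.prems] .
    have zu: "commutator z u \<in> G (t + n)"
      unfolding commutator_def
      using mult_G[OF z u(1)] mult_G[OF u(1) z] subspace_diff[OF subspace_G]
      by (simp add: add.commute)
    have xt: "x \<in> filt t"
      using filt_add[OF G_filt[OF z order_refl] filt_mono[OF _ x, of t]] by simp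
    have "commutator x y - commutator z u
        = (x * (y - u) - (y - u) * x) + ((x - z) * u - u * (x - z))"
      by (simp add: commutator_def algebra_simps)
    moreover have "x * (y - u) \<in> filt (t + n - 1)" "(y - u) * x \<in> filt (t + n - 1)"
      "(x - z) * u \<in> filt (t + n - 1)" "u * (x - z) \<in> filt (t + n - 1)"
      using filt_mult[OF xt u(2)] filt_mult[OF u(2) xt]
        filt_mult[OF x G_filt[OF u(1) order_refl]] filt_mult[OF G_filt[OF u(1) order_refl] x]
      by (simp_all add: algebra_simps)
    ultimately have lower: "commutator x y - commutator z u \<in> filt (t + n - 1)"
      by (simp add: filt_add filt_diff)
    show ?case
    proof
      assume xy: "commutator x y = 1"
      \<comment> \<open>By \<open>lower\<close>, \<open>[z, u]\<close> is the component of degree \<open>t + n\<close> of \<open>1\<close>.\<close>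
      consider "t + n < 0" | "t + n = 0" | "t + n > 0" by linarith
      then show False
      proof cases
        case 1
        have "1 - commutator z u + commutator z u \<in> filt (t + n)"
          using lower xy by (intro filt_add G_filt[OF zu order_refl]) (auto intro: filt_mono[rotated])
        then show False using G_filt_zero[OF one_G] 1 by simp
      next
        case 2
        have "1 - commutator z u \<in> G 0"
          using zu 2 one_G subspace_diff[OF subspace_G] by simp
        then have "1 - commutator z u = 0"
          using G_filt_zero lower xy 2 by (metis zero_less_one diff_less_eq add_0)
        moreover have "n = - t" using 2 by simp
        ultimately show False using key u(1) by simp
      next
        case 3
        have "1 \<in> filt (t + n - 1)" using G_filt[OF one_G] 3 by simp
        then have "1 - (1 - commutator z u) \<in> filt (t + n - 1)"
          using lower xy filt_diff by metis
        then have "commutator z u = 0" using G_filt_zero[OF zu] by simp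
        then have "u \<in> polynomials_in scale z" using centr by (auto simp: centralizer_def)
        then obtain P where P: "u = (\<Sum>k\<le>degree P. scale (coeff P k) (z ^ k))"
          by (auto simp: polynomials_in_def eval_poly_at_def)
        \<comment> \<open>For \<open>u = 0\<close> the exponent is arbitrary, but then nothing is subtracted from \<open>y\<close>.\<close>
        have "\<exists>a k. u = scale a (z ^ k) \<and> (a = 0 \<or> int k * t = n)"
        proof (cases "u = 0")
          case True
          then show ?thesis by (auto intro!: exI[of _ 0])
        next
          case False
          then show ?thesis using homogeneous_polynomial_is_monomial[OF z t u(1) _ P] by blast
        qed
        then obtain a k where ak: "u = scale a (z ^ k)" "a = 0 \<or> int k * t = n" by blast
        define y' where "y' = y - scale a (x ^ k)"
        have "scale a (x ^ k - z ^ k) \<in> filt (n - 1)"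
          using ak(2) filt_power_diff[OF z x, of k] by (auto simp: filt_0 intro: filt_scale)
        with u(2) have "(y - u) - scale a (x ^ k - z ^ k) \<in> filt (n - 1)"
          by (rule filt_diff)
        then have "y' \<in> filt (n - 1)"
          by (simp add: y'_def ak(1) scale_right_diff_distrib)
        moreover have "commutator x y' = 1"
          using xy by (simp add: y'_def commutator_diff_right commutator_scale_right)
            (simp add: commutator_def power_commutes)
        ultimately show False using less.hyps[of "n - 1" y'] 3 by simp
      qed
    qed
  qed
  then show ?thesis using filt_exhaust unfolding solvable_def by blast
qed

lemma sum_minus_leading_filt:
  assumes "s \<le> t" and "\<And>i. i \<in> {s..t} \<Longrightarrow> w i \<in> G i"
  shows "(\<Sum>i\<in>{s..t}. w i) - w t \<in> filt (t - 1)"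
proof -
  have "(\<Sum>i\<in>{s..t}. w i) - w t = (\<Sum>i\<in>{s..t} - {t}. w i)"
    using assms(1) by (simp add: sum_diff1)
  also have "\<dots> \<in> filt (t - 1)"
    by (rule subspace_sum[OF subspace_filt]) (use assms(2) in \<open>force intro: G_filt\<close>)
  finally show ?thesis .
qed

end

section \<open>The grading of the Weyl algebra\<close>

context weyl_algebra
begin

abbreviation g :: 'a where "g \<equiv> p * q"

text \<open>
  The degree-\<open>n\<close> component turns out to be the eigenspace of the derivation \<open>[p q, _]\<close> for the
  eigenvalue \<open>n\<close> (\<open>eigenspace_eq_component\<close>). In this form the grading is multiplicative by the
  Leibniz rule, without bringing products of monomials into normal form, and it is direct because
  eigenspaces for distinct eigenvalues are independent.
\<close>

definition eigenspace :: "int \<Rightarrow> 'a set" where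
  "eigenspace n = {z. commutator g z = scale (of_int n) z}"

lemma subspace_eigenspace: "subspace (eigenspace n)"
  by (rule subspaceI)
    (auto simp: eigenspace_def commutator_add_right commutator_scale_right scale_right_distrib
      mult.commute scale_scale commutator_def[of _ 0])

lemma eigenspace_mult:
  assumes "y \<in> eigenspace m" "z \<in> eigenspace n"
  shows "y * z \<in> eigenspace (m + n)"
proof -
  have "commutator g (y * z) = commutator g y * z + y * commutator g z"
    by (simp add: commutator_def algebra_simps)
  then show ?thesis
    using assms by (simp add: eigenspace_def scale_mult_left scale_mult_right scale_left_distrib)
qed

lemma eigenspace_one: "1 \<in> eigenspace 0"
  by (simp add: eigenspace_def commutator_def)

lemma q_p: "q * p = g - 1"
  using pq_relation by (simp add: algebra_simps)

lemma p_g: "p * g = (g + 1) * p"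
  by (simp add: distrib_right mult.assoc q_p) (simp add: algebra_simps)

lemma q_g: "q * g = (g - 1) * q"
  by (simp add: q_p[symmetric] mult.assoc)

lemma eigenspace_power:
  assumes "z \<in> eigenspace n"
  shows "z ^ k \<in> eigenspace (int k * n)"
proof (induction k)
  case (Suc k)
  show ?case using eigenspace_mult[OF assms Suc] by (simp add: algebra_simps)
qed (simp add: eigenspace_one)

lemma monomial_eigenspace: "p ^ i * q ^ j \<in> eigenspace (int j - int i)"
proof -
  have "p \<in> eigenspace (- 1)" "q \<in> eigenspace 1"
    using p_g q_g by (simp_all add: eigenspace_def commutator_def algebra_simps)
  from eigenspace_mult[OF eigenspace_power[OF this(1), of i] eigenspace_power[OF this(2), of j]]
  show ?thesis by simp
qed

text \<open>
  Applying \<open>[g, _] - d(b)\<close> to the sum removes the summand \<open>f b\<close>, rescales the others, and multiplies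
  the sum itself by \<open>n - d(b) \<noteq> 0\<close>. Several summands may belong to the same
  eigenvalue, as happens in a linear combination of arbitrary eigenvectors.
\<close>

lemma eigenspaces_sum:
  assumes "finite T" and "\<And>a. a \<in> T \<Longrightarrow> d a \<noteq> n \<and> f a \<in> eigenspace (d a)"
    and "(\<Sum>a\<in>T. f a) \<in> eigenspace n"
  shows "(\<Sum>a\<in>T. f a) = 0"
  using assms
proof (induction T arbitrary: f rule: finite_induct)
  case (insert b T)
  let ?w = "\<Sum>a\<in>insert b T. f a"
  let ?D = "\<lambda>v. commutator g v - scale (of_int (d b)) v"
  have D: "?D v = scale (of_int m - of_int (d b)) v" if "v \<in> eigenspace m" for v m
    using that by (simp add: eigenspace_def scale_left_diff_distrib)
  define f' where "f' a = scale (of_int (d a) - of_int (d b)) (f a)" for a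
  have "?D ?w = (\<Sum>a\<in>insert b T. ?D (f a))"
    by (simp only: commutator_def sum_distrib_left sum_distrib_right sum_subtractf scale_sum_right)
  also have "\<dots> = (\<Sum>a\<in>insert b T. f' a)"
    unfolding f'_def by (rule sum.cong) (use insert.prems(1) D in auto)
  also have "\<dots> = (\<Sum>a\<in>T. f' a)"
    using insert.hyps by (simp add: f'_def)
  finally have eq: "scale (of_int n - of_int (d b)) ?w = (\<Sum>a\<in>T. f' a)"
    using D[OF insert.prems(2)] by simp
  have "(\<Sum>a\<in>T. f' a) = 0"
  proof (rule insert.IH)
    show "d a \<noteq> n \<and> f' a \<in> eigenspace (d a)" if "a \<in> T" for a
      using insert.prems(1)[of a] that subspace_scale[OF subspace_eigenspace]
      by (auto simp: f'_def)
    show "(\<Sum>a\<in>T. f' a) \<in> eigenspace n"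
      unfolding eq[symmetric] by (rule subspace_scale[OF subspace_eigenspace insert.prems(2)])
  qed
  with eq insert.prems(1)[of b] show ?case by simp
qed simp

lemma eigenspaces_direct:
  assumes "u \<in> eigenspace n" "u \<in> span (\<Union>i\<in>- {n}. eigenspace i)"
  shows "u = 0"
proof -
  obtain T r where T: "finite T" "T \<subseteq> (\<Union>i\<in>- {n}. eigenspace i)"
    and u: "u = (\<Sum>a\<in>T. scale (r a) a)"
    using assms(2) unfolding span_explicit by blast
  from T(2) have "\<forall>a\<in>T. \<exists>i. i \<noteq> n \<and> a \<in> eigenspace i" by auto
  then obtain d where d: "\<And>a. a \<in> T \<Longrightarrow> d a \<noteq> n \<and> a \<in> eigenspace (d a)" by metis
  show ?thesis
    unfolding u
  proof (rule eigenspaces_sum[OF T(1), of d n])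
    show "d a \<noteq> n \<and> scale (r a) a \<in> eigenspace (d a)" if "a \<in> T" for a
      using d[OF that] subspace_scale[OF subspace_eigenspace] by blast
  qed (use assms(1) u in simp)
qed

abbreviation component :: "int \<Rightarrow> 'a set" where
  "component \<equiv> graded_component scale p q"

lemma component_subset_eigenspace: "component n \<subseteq> eigenspace n"
  unfolding graded_component_def
  by (rule span_minimal[OF _ subspace_eigenspace]) (use monomial_eigenspace in auto)

lemma span_components: "span (\<Union>i. component i) = UNIV"
proof -
  have "range (\<lambda>(i::nat, j::nat). p ^ i * q ^ j) \<subseteq> (\<Union>i. component i)"
    unfolding graded_component_def by (force intro: span_base)
  from span_mono[OF this] show ?thesis using monomials_span by auto
qed

text \<open>
  The components span the algebra, so an eigenvector differs from an element of the component by
  a combination of eigenvectors for other eigenvalues, which is zero by directness.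
\<close>

lemma eigenspace_eq_component: "eigenspace n = component n"
proof (rule equalityI[OF subsetI component_subset_eigenspace])
  fix u assume u: "u \<in> eigenspace n"
  have "(\<Union>i. component i) = component n \<union> (\<Union>i\<in>- {n}. component i)" by auto
  then have "u \<in> span (component n \<union> (\<Union>i\<in>- {n}. component i))"
    using span_components by simp
  then obtain a w where a: "a \<in> span (component n)" and w: "w \<in> span (\<Union>i\<in>- {n}. component i)"
    and uaw: "u = a + w"
    unfolding span_Un by auto
  have a': "a \<in> component n" using a by (simp add: graded_component_def span_span)
  have "w = u - a" using uaw by simp
  then have "w \<in> eigenspace n"
    using u a' component_subset_eigenspace subspace_diff[OF subspace_eigenspace] by blast
  moreover have "w \<in> span (\<Union>i\<in>- {n}. eigenspace i)"
    by (rule subsetD[OF span_mono w]) (use component_subset_eigenspace in blast)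
  ultimately have "w = 0" by (rule eigenspaces_direct)
  then show "u \<in> component n" using uaw a' by simp
qed

lemma graded_algebra_components: "graded_algebra scale component"
proof unfold_locales
  show "subspace (component i)" for i by (simp add: graded_component_def)
  show "x * y \<in> component (i + j)" if "x \<in> component i" "y \<in> component j" for x y i j
    using eigenspace_mult that by (simp add: eigenspace_eq_component)
  show "1 \<in> component 0" using eigenspace_one by (simp add: eigenspace_eq_component)
  show "span (\<Union>i. component i) = UNIV" by (rule span_components)
  show "x = 0" if "x \<in> component i" "x \<in> span (\<Union>j\<in>- {i}. component j)" for x i
    using eigenspaces_direct that by (simp add: eigenspace_eq_component)
qed

section \<open>Homogeneous elements\<close>

text \<open>
  Left multiplication by \<open>p\<close> sends the basis monomials to basis monomials with a positive power of
  \<open>p\<close>, and \<open>q^n\<close> is not among these.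
\<close>

lemma q_power_not_left_multiple_of_p: "q ^ n \<noteq> p * a"
proof
  assume eq: "q ^ n = p * a"
  let ?B = "range (\<lambda>(i::nat, j::nat). p ^ i * q ^ j)"
  have qB: "q ^ n \<in> ?B" by (auto intro: image_eqI[of _ _ "(0, n)"])
  have "a \<in> span ?B" using monomials_span by simp
  then have "p * a \<in> span (?B - {q ^ n})"
  proof (induction rule: span_induct_alt)
    case (step c b z)
    then obtain i j where b: "b = p ^ i * q ^ j" by auto
    have "p ^ Suc i * q ^ j \<noteq> q ^ n"
      using injD[OF monomials_inj, of "(Suc i, j)" "(0, n)"] by auto
    then have "p * b \<in> ?B - {q ^ n}"
      by (auto simp: b mult.assoc intro: image_eqI[of _ _ "(Suc i, j)"])
    with step show ?case
      by (simp add: distrib_left scale_mult_right span_add span_scale span_base)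
  qed (simp add: span_zero)
  then show False using monomials_independent qB eq unfolding dependent_def by metis
qed

lemma q_power_eval: "q ^ n * ev P g = ev P (g - of_nat n) * q ^ n"
proof (rule eval_intertwine)
  show "q ^ n * g = (g - of_nat n) * q ^ n"
  proof (induction n)
    case (Suc n)
    have "q ^ Suc n * g = q * ((g - of_nat n) * q ^ n)"
      by (simp only: power_Suc mult.assoc Suc)
    also have "\<dots> = (q * g - q * of_nat n) * q ^ n"
      by (simp only: right_diff_distrib left_diff_distrib mult.assoc)
    also have "\<dots> = (g - 1 - of_nat n) * q * q ^ n"
      by (simp only: q_g mult_of_nat_commute left_diff_distrib)
    also have "\<dots> = (g - of_nat (Suc n)) * q ^ Suc n"
      by (simp add: mult.assoc diff_diff_eq)
    finally show ?case .
  qed simp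
qed

lemma p_power_eval: "p ^ n * ev P g = ev P (g + of_nat n) * p ^ n"
proof (rule eval_intertwine)
  show "p ^ n * g = (g + of_nat n) * p ^ n"
  proof (induction n)
    case (Suc n)
    have "p ^ Suc n * g = p * ((g + of_nat n) * p ^ n)"
      by (simp only: power_Suc mult.assoc Suc)
    also have "\<dots> = (p * g + p * of_nat n) * p ^ n"
      by (simp only: distrib_left distrib_right mult.assoc)
    also have "\<dots> = (g + 1 + of_nat n) * p * p ^ n"
      by (simp only: p_g mult_of_nat_commute distrib_right)
    also have "\<dots> = (g + of_nat (Suc n)) * p ^ Suc n"
      by (simp add: mult.assoc add.assoc)
    finally show ?case .
  qed simp
qed

text \<open>
  Modulo the right ideal \<open>p A\<close>, which contains \<open>g\<close>, the element \<open>q^n P(g) = P(g - n) q^n\<close> is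
  \<open>P(-n) q^n\<close>. Since \<open>q^n\<close> is not in \<open>p A\<close>, the relation \<open>P(g) = 0\<close> makes every \<open>-n\<close> a root of \<open>P\<close>.
\<close>

lemma eval_g_eq_0:
  assumes "ev P g = 0"
  shows "P = 0"
proof (rule poly_eq_0_of_arithmetic_progression[of "- 1" _ 0])
  fix n
  let ?a = "- 1 * of_nat n + 0 :: 'f"
  have arg: "g - of_nat n = g + scale ?a 1" by (simp add: scale_of_nat)
  obtain c where c: "ev P (g + scale ?a 1) = scale (poly P ?a) 1 + g * c"
    using eval_remainder by blast
  have "(scale (poly P ?a) 1 + g * c) * q ^ n = 0"
    using q_power_eval[of n P] assms unfolding arg c by simp
  then have *: "scale (poly P ?a) (q ^ n) = p * (- (q * c * q ^ n))"
    by (simp add: distrib_right scale_mult_left mult.assoc eq_neg_iff_add_eq_0)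
  show "poly P ?a = 0"
  proof (rule ccontr)
    assume nz: "poly P ?a \<noteq> 0"
    have "q ^ n = scale (inverse (poly P ?a)) (scale (poly P ?a) (q ^ n))"
      using nz by simp
    also have "\<dots> = p * scale (inverse (poly P ?a)) (- (q * c * q ^ n))"
      unfolding * by (simp only: scale_mult_right)
    finally show False using q_power_not_left_multiple_of_p by blast
  qed
qed simp

lemma p_power_q_power: "p ^ n * q ^ n = ev (rising n) g"
proof (induction n)
  case 0
  then show ?case by (simp add: rising_def eval_1)
next
  case (Suc n)
  have "p ^ Suc n * q ^ Suc n = p ^ n * g * q ^ n"
    by (simp only: power_Suc2[of p] power_Suc[of q] mult.assoc)
  also have "\<dots> = p ^ n * ev [:0, 1:] g * q ^ n"
    by (simp add: eval_linear)
  also have "\<dots> = (g + of_nat n) * (p ^ n * q ^ n)"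
    unfolding p_power_eval by (simp add: eval_linear mult.assoc)
  also have "\<dots> = ev [:of_nat n, 1:] g * ev (rising n) g"
    by (simp only: Suc eval_linear scale_of_nat mult_1_right add.commute)
  finally show ?case by (simp only: rising_Suc eval_mult)
qed

lemma q_power_p_power: "q ^ n * p ^ n = ev (falling n) g"
proof (induction n)
  case 0
  then show ?case by (simp add: falling_def eval_1)
next
  case (Suc n)
  have "q ^ Suc n * p ^ Suc n = q ^ n * (q * p) * p ^ n"
    by (simp only: power_Suc2[of q] power_Suc[of p] mult.assoc)
  also have "\<dots> = q ^ n * ev [:- 1, 1:] g * p ^ n"
    by (simp add: eval_linear q_p)
  also have "\<dots> = (g - of_nat (Suc n)) * (q ^ n * p ^ n)"
    unfolding q_power_eval by (simp add: eval_linear mult.assoc algebra_simps)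
  also have "\<dots> = ev [:- of_nat (Suc n), 1:] g * ev (falling n) g"
    unfolding Suc by (simp add: eval_linear scale_of_nat del: of_nat_Suc)
  finally show ?case by (simp only: falling_Suc eval_mult)
qed

lemma component_nonneg:
  assumes "u \<in> component (int n)"
  shows "\<exists>f. u = ev f g * q ^ n"
  using assms unfolding graded_component_def
proof (induction rule: span_induct_alt)
  case base
  then show ?case by (auto simp: eval_0 intro: exI[of _ 0])
next
  case (step c b z)
  then obtain i j f where b: "b = p ^ i * q ^ j" and ij: "int j - int i = int n"
    and f: "z = ev f g * q ^ n"
    by auto
  have "j = i + n" using ij by simp
  then have "b = ev (rising i) g * q ^ n"
    by (simp add: b power_add p_power_q_power flip: mult.assoc)
  then have "scale c b + z = ev (smult c (rising i) + f) g * q ^ n"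
    by (simp add: f eval_add eval_smult distrib_right scale_mult_left)
  then show ?case by blast
qed

lemma component_nonpos:
  assumes "v \<in> component (- int n)"
  shows "\<exists>k. v = p ^ n * ev k g"
  using assms unfolding graded_component_def
proof (induction rule: span_induct_alt)
  case base
  then show ?case by (auto simp: eval_0 intro: exI[of _ 0])
next
  case (step c b z)
  then obtain i j k where b: "b = p ^ i * q ^ j" and ij: "int j - int i = - int n"
    and k: "z = p ^ n * ev k g"
    by auto
  have "i = n + j" using ij by simp
  then have "b = p ^ n * ev (rising j) g"
    by (simp add: b power_add p_power_q_power mult.assoc)
  then have "scale c b + z = p ^ n * ev (smult c (rising j) + k) g"
    by (simp add: k eval_add eval_smult distrib_left scale_mult_right)
  then show ?case by blast
qed

text \<open>
  Here \<open>n > 1\<close> enters: \<open>falling n\<close> then has the two roots 1 and 2. For \<open>n = 1\<close> the pair \<open>u = - q\<close>,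
  \<open>v = p\<close> has commutator 1, with \<open>F = 1 - X\<close>.
\<close>

lemma homogeneous_commutator_ne_one_nat:
  assumes n: "n > 1" and u: "u \<in> component (int n)" and v: "v \<in> component (- int n)"
  shows "commutator u v \<noteq> 1"
proof
  assume uv: "commutator u v = 1"
  obtain f where f: "u = ev f g * q ^ n" using component_nonneg[OF u] by blast
  obtain k where k: "v = p ^ n * ev k g" using component_nonpos[OF v] by blast
  define F where "F = f * k * falling n"
  have "u * v = ev f g * ((q ^ n * p ^ n) * ev k g)"
    by (simp add: f k mult.assoc)
  also have "\<dots> = ev (f * (falling n * k)) g"
    by (simp add: q_power_p_power eval_mult)
  finally have 1: "u * v = ev F g"
    by (simp add: F_def mult.commute mult.left_commute)
  let ?s = "[:of_nat n, 1:] :: 'f poly"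
  have s: "g + of_nat n = ev ?s g"
    by (simp add: eval_linear scale_of_nat add.commute)
  have "v * u = p ^ n * ev (k * f) g * q ^ n"
    by (simp add: f k eval_mult mult.assoc)
  also have "\<dots> = ev (pcompose (k * f) ?s) g * (p ^ n * q ^ n)"
    by (simp only: p_power_eval s eval_pcompose mult.assoc)
  also have "\<dots> = ev (pcompose (k * f) ?s * pcompose (falling n) ?s) g"
    by (simp only: p_power_q_power rising_eq_shifted_falling eval_mult)
  finally have 2: "v * u = ev (pcompose F ?s) g"
    by (simp add: F_def pcompose_mult mult.commute mult.left_commute)
  have "ev (F - pcompose F ?s - 1) g = 0"
    using uv by (simp add: eval_diff eval_1 commutator_def 1 2)
  then have "F - pcompose F ?s - 1 = 0" by (rule eval_g_eq_0)
  then have "poly (F - pcompose F ?s - 1) x = 0" for x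
    by simp
  then have eq: "poly F x - poly F (x + of_nat n) = 1" for x
    by (simp add: poly_pcompose add.commute)
  have "poly (falling n) (1 :: 'f) = 0" "poly (falling n) (2 :: 'f) = 0"
    using n by (auto simp: falling_def poly_prod intro: bexI[of _ 0] bexI[of _ 1])
  then have "poly F 1 = poly F 2" by (simp add: F_def)
  with no_shift_antiderivative[of n F] eq n show False by simp
qed

text \<open>
  For negative \<open>t\<close> the roles are exchanged by \<open>[u, v] = [v, - u]\<close>.
\<close>

lemma homogeneous_commutator_ne_one:
  assumes "\<bar>t\<bar> > 1" "u \<in> component t" "v \<in> component (- t)"
  shows "commutator u v \<noteq> 1"
proof (cases "t > 0")
  case True
  then show ?thesis using homogeneous_commutator_ne_one_nat[of "nat t" u v] assms by simp
next
  case False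
  have "- u \<in> component t"
    using assms(2) by (simp add: graded_component_def span_neg)
  then have "commutator v (- u) \<noteq> 1"
    using homogeneous_commutator_ne_one_nat[of "nat (- t)" v "- u"] False assms by simp
  then show ?thesis by (simp add: commutator_def)
qed

end

section \<open>Unsolvable elements\<close>

theorem theorem4p2:
  fixes scale :: "'f::field_char_0 \<Rightarrow> 'a::ring_1 \<Rightarrow> 'a"
    and p q :: 'a
    and s t :: int
    and xs :: "int \<Rightarrow> 'a"
    and x :: 'a
  assumes "weyl_algebra scale p q"
    and "s \<le> t"
    and "\<And>i. i \<in> {s..t} \<Longrightarrow> xs i \<in> graded_component scale p q i"
    and "x = (\<Sum>i\<in>{s..t}. xs i)"
    and "(xs t \<noteq> 0 \<and> t > 1 \<and> centralizer (xs t) = polynomials_in scale (xs t)) \<or>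
         (xs s \<noteq> 0 \<and> s < - 1 \<and> centralizer (xs s) = polynomials_in scale (xs s))"
  shows "unsolvable x"
proof -
  interpret weyl_algebra scale p q by fact
  interpret up: graded_algebra scale component by (rule graded_algebra_components)
  interpret down: graded_algebra scale "\<lambda>i. component (- i)" by (rule up.opposite_grading)
  from assms(5) show ?thesis
  proof
    assume *: "xs t \<noteq> 0 \<and> t > 1 \<and> centralizer (xs t) = polynomials_in scale (xs t)"
    show ?thesis
    proof (rule up.unsolvable_of_leading_component)
      show mem: "xs t \<in> component t" using assms(2,3) by simp
      show "commutator (xs t) v \<noteq> 1" if "v \<in> component (- t)" for v
        using homogeneous_commutator_ne_one[OF _ mem that] * by simp
      show "x - xs t \<in> up.filt (t - 1)"
        unfolding assms(4) using assms(2,3) by (rule up.sum_minus_leading_filt)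
    qed (use * in auto)
  next
    assume *: "xs s \<noteq> 0 \<and> s < - 1 \<and> centralizer (xs s) = polynomials_in scale (xs s)"
    have "x = (\<Sum>i\<in>{- t..- s}. xs (- i))"
      unfolding assms(4) by (rule sum.reindex_bij_witness[of _ uminus uminus]) auto
    moreover have "(\<Sum>i\<in>{- t..- s}. xs (- i)) - xs (- (- s)) \<in> down.filt (- s - 1)"
      by (rule down.sum_minus_leading_filt) (use assms(2,3) in auto)
    ultimately have lead: "x - xs s \<in> down.filt (- s - 1)" by simp
    have mem: "xs s \<in> component s" using assms(2,3) by simp
    show ?thesis
    proof (rule down.unsolvable_of_leading_component[OF _ _ lead])
      show "xs s \<in> component (- (- s))" using mem by simp
      show "commutator (xs s) v \<noteq> 1" if "v \<in> component (- (- (- s)))" for v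
        using homogeneous_commutator_ne_one[OF _ mem] that * by simp
    qed (use * in auto)
  qed
qed

end
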